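(* Let $X=(X,d,\mu)$ be a metric measure space satisfying the standing assumptions of the context (in particular $\mu$ is doubling). Let $\alpha\in\mathbb R$, $1\le p\le q<\infty$, $0<s<1$ with $\alpha<s$, and $1\le t<\infty$. Assume that $X$ is complete and supports a $(s,q,p,t)$-Poincaré inequality and that $\mu$ is reverse doubling. Let $E\subset X$ be a closed set with $\overline{\operatorname{co\,dim}}_A(E)<sp$, and assume that $u\colon X\to\mathbb R$ is a continuous function such that $u=0$ on $E$. Then there is a constant $C>0$, independent of $u$, such that \[ |u(x)|\le C\,d(x,E)^{s-\alpha}\Bigl(M_{\alpha p}\bigl(\chi_B\,(g_{u,s,t,B})^p\bigr)(x)\Bigr)^{1/p} \] whenever $x\in X$ satisfies $0<d(x,E)<\operatorname{diam}(E)$ and $B=B(x,2d(x,E))$.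
   Context: Standing assumptions: $X=(X,d,\mu)$ is a metric measure space with at least two points, where $\mu$ is a Borel measure supported on $X$ such that $\mu(\{x\})=0$ for all $x\in X$ and $0<\mu(B)<\infty$ for all open balls $B=B(x,r)=\{y\in X: d(x,y)<r\}$, $r>0$. Each ball has a fixed center and radius, and $\lambda B(x,r)=B(x,\lambda r)$. The measure $\mu$ is doubling: there is $c_D\ge1$ such that $\mu(B(x,2r))\le c_D\,\mu(B(x,r))$ for all $x\in X$, $r>0$. Here $d(x,E)$ is the distance from $x$ to $E$ and $\chi_B$ is the characteristic function of $B$. Reverse doubling: there are constants $0<\kappa<1$ and $0<c_R<1$ such that $\mu(B(x,\kappa r))\le c_R\,\mu(B(x,r))$ for every $x\in X$ and $0<r<\operatorname{diam}(X)/2$. For a measurable $u\colon X\to\mathbb R$ and a measurable set $A\subset X$, \[ g_{u,s,t,A}(x)=\biggl(\int_A\frac{|u(x)-u(y)|^t}{d(x,y)^{st}\mu(B(x,d(x,y)))}\,d\mu(y)\biggr)^{1/t},\qquad x\in X. \] Fractional maximal function: for $\beta\in\mathbb R$ and a measurable function $f$ on $X$, $M_\beta f(x)=\sup_{r>0}r^\beta\frac1{\mu(B(x,r))}\int_{B(x,r)}|f(y)|\,d\mu(y)$. A function $u\colon X\to\mathbb R$ is integrable on balls if it is $\mu$-measurable and $\int_B|u|\,d\mu<\infty$ for every ball $B\subset X$; then $u_B=\frac1{\mu(B)}\int_B u\,d\mu$. $(s,q,p,t)$-Poincaré inequality ($1\le p,q,t<\infty$, $0<s<1$): $X$ supports it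 if there are constants $c_P>0$ and $\lambda\ge1$ such that \[ \biggl(\frac1{\mu(B)}\int_B|u(x)-u_B|^q\,d\mu(x)\biggr)^{1/q}\le c_Pr^s\biggl(\frac1{\mu(\lambda B)}\int_{\lambda B}g_{u,s,t,\lambda B}(x)^p\,d\mu(x)\biggr)^{1/p} \] for every ball $B=B(x_0,r)\subset X$ and all $u\colon X\to\mathbb R$ integrable on balls (in particular the left-hand side is finite if the right-hand side is finite). Upper Assouad codimension: for $E\subset X$ and $r>0$ let $E_r=\{x\in X:\operatorname{dist}(x,E)<r\}$. Then $\overline{\operatorname{co\,dim}}_A(E)$ is the infimum of all $Q\ge0$ for which there is $c>0$ such that \[ \frac{\mu(E_r\cap B(x,R))}{\mu(B(x,R))}\ge c\Bigl(\frac rR\Bigr)^Q \] for every $x\in E$ and all $0<r<R<\operatorname{diam}(E)$. If $E$ consists of one point, the restriction $R<\operatorname{diam}(E)$ is removed. *)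

theory Defs
  imports "HOL-Analysis.Analysis"
begin

text \<open>
  The space is the whole type. Extended nonnegative quantities (the function g, maximal
  functions, means of nonnegative functions) take values in \<^typ>\<open>ennreal\<close>, so that
  infinite values are admitted; diameters and codimensions take values in \<^typ>\<open>ereal\<close>,
  since the real-valued \<^const>\<open>diameter\<close> is meaningful for bounded sets only.
\<close>

definition ennreal_powr :: "ennreal \<Rightarrow> real \<Rightarrow> ennreal" where
  \<comment> \<open>only used for positive exponents, for which infinity is mapped to infinity\<close>
  "ennreal_powr a e = (if a = \<infinity> then \<infinity> else ennreal (enn2real a powr e))"

definition ediam :: "'a::metric_space set \<Rightarrow> ereal" where
  "ediam E = (if E = {} then 0 else SUP (x, y) \<in> E \<times> E. ereal (dist x y))"

definition metric_measure_space :: "'a::metric_space measure \<Rightarrow> bool" where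
  \<comment> \<open>full support is contained in the positivity of the measure of balls\<close>
  "metric_measure_space \<mu> \<longleftrightarrow>
     (\<exists>x y :: 'a. x \<noteq> y) \<and>
     sets \<mu> = sets borel \<and>
     (\<forall>x. emeasure \<mu> {x} = 0) \<and>
     (\<forall>x r. 0 < r \<longrightarrow> 0 < emeasure \<mu> (ball x r) \<and> emeasure \<mu> (ball x r) < \<infinity>)"

definition doubling :: "'a::metric_space measure \<Rightarrow> bool" where
  "doubling \<mu> \<longleftrightarrow>
     (\<exists>c\<^sub>D\<ge>1. \<forall>x r. 0 < r \<longrightarrow> measure \<mu> (ball x (2 * r)) \<le> c\<^sub>D * measure \<mu> (ball x r))"

definition reverse_doubling :: "'a::metric_space measure \<Rightarrow> bool" where
  "reverse_doubling \<mu> \<longleftrightarrow>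
     (\<exists>\<kappa> c\<^sub>R. 0 < \<kappa> \<and> \<kappa> < 1 \<and> 0 < c\<^sub>R \<and> c\<^sub>R < 1 \<and>
       (\<forall>x r. 0 < r \<and> ereal r < ediam (UNIV :: 'a set) / 2 \<longrightarrow>
          measure \<mu> (ball x (\<kappa> * r)) \<le> c\<^sub>R * measure \<mu> (ball x r)))"

definition nn_mean :: "'a measure \<Rightarrow> 'a set \<Rightarrow> ('a \<Rightarrow> ennreal) \<Rightarrow> ennreal" where
  "nn_mean \<mu> A f = (\<integral>\<^sup>+ x \<in> A. f x \<partial>\<mu>) / emeasure \<mu> A"

definition mean :: "'a measure \<Rightarrow> 'a set \<Rightarrow> ('a \<Rightarrow> real) \<Rightarrow> real" where
  "mean \<mu> A u = (LINT x:A|\<mu>. u x) / measure \<mu> A"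

definition frac_grad ::
    "'a::metric_space measure \<Rightarrow> ('a \<Rightarrow> real) \<Rightarrow> real \<Rightarrow> real \<Rightarrow> 'a set \<Rightarrow> 'a \<Rightarrow> ennreal" where
  \<comment> \<open>the integrand is 0/0 at y = x, a point of measure zero\<close>
  "frac_grad \<mu> u s t A x =
     ennreal_powr
       (\<integral>\<^sup>+ y \<in> A. ennreal (\<bar>u x - u y\<bar> powr t) /
          (ennreal (dist x y powr (s * t)) * emeasure \<mu> (ball x (dist x y))) \<partial>\<mu>)
       (1 / t)"

definition frac_maximal ::
    "'a::metric_space measure \<Rightarrow> real \<Rightarrow> ('a \<Rightarrow> ennreal) \<Rightarrow> 'a \<Rightarrow> ennreal" where
  \<comment> \<open>the argument f stands for the absolute value of the function, possibly infinite\<close>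
  "frac_maximal \<mu> \<beta> f x = (SUP r \<in> {0<..}. ennreal (r powr \<beta>) * nn_mean \<mu> (ball x r) f)"

definition integrable_on_balls :: "'a::metric_space measure \<Rightarrow> ('a \<Rightarrow> real) \<Rightarrow> bool" where
  "integrable_on_balls \<mu> u \<longleftrightarrow>
     u \<in> borel_measurable \<mu> \<and> (\<forall>x r. 0 < r \<longrightarrow> (\<integral>\<^sup>+ y \<in> ball x r. ennreal \<bar>u y\<bar> \<partial>\<mu>) < \<infinity>)"

definition supports_poincare ::
    "'a::metric_space measure \<Rightarrow> real \<Rightarrow> real \<Rightarrow> real \<Rightarrow> real \<Rightarrow> bool" where
  "supports_poincare \<mu> s q p t \<longleftrightarrow>
     (\<exists>c\<^sub>P>0. \<exists>\<Lambda>\<ge>1. \<forall>x\<^sub>0 r u. 0 < r \<and> integrable_on_balls \<mu> u \<longrightarrow>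
        ennreal_powr
          (nn_mean \<mu> (ball x\<^sub>0 r) (\<lambda>x. ennreal (\<bar>u x - mean \<mu> (ball x\<^sub>0 r) u\<bar> powr q))) (1 / q)
        \<le> ennreal (c\<^sub>P * r powr s) *
          ennreal_powr
            (nn_mean \<mu> (ball x\<^sub>0 (\<Lambda> * r))
              (\<lambda>x. ennreal_powr (frac_grad \<mu> u s t (ball x\<^sub>0 (\<Lambda> * r)) x) p)) (1 / p))"

definition upper_assouad_codim :: "'a::metric_space measure \<Rightarrow> 'a set \<Rightarrow> ereal" where
  "upper_assouad_codim \<mu> E =
     Inf (ereal ` {Q. 0 \<le> Q \<and>
       (\<exists>c>0. \<forall>x\<in>E. \<forall>r R. 0 < r \<and> r < R \<and> (is_singleton E \<or> ereal R < ediam E) \<longrightarrow>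
          measure \<mu> ({y. infdist y E < r} \<inter> ball x R) / measure \<mu> (ball x R) \<ge> c * (r / R) powr Q)})"

end

theory Submission
  imports Defs
begin

text \<open>
  On a ball \<open>B\<^sub>1\<close> the oscillation of \<open>u\<close> around \<open>u y\<close> in the mean is at most \<open>C r\<^sup>s g(y)\<close>, by doubling alone.
  Chebyshev's inequality therefore yields, along nested balls of comparable measure, points \<open>z\<^sub>k\<close> in
  the \<open>k\<close>-th ball with \<open>\<bar>u z\<^sub>k - u z\<^sub>k\<^sub>+\<^sub>1\<bar>\<close> bounded by \<open>r\<^sub>k\<^sup>s\<close> times the \<open>L\<^sup>p\<close>-mean of \<open>g\<close> on that ball.
  Starting from one good point of \<open>B\<close>, the balls \<open>B(x, 2d/2\<^sup>k)\<close> lead to \<open>u x\<close>; here \<open>\<alpha> < s\<close> makes the bounds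
  summable. A second chain leads to a zero of \<open>u\<close> in \<open>E\<close>: put \<open>\<psi>(w,r) = \<mu>(B(w,r)) r\<^sup>-\<^sup>s\<^sup>p\<close>. As the
  codimension of \<open>E\<close> is below \<open>sp\<close>, a ball centred on \<open>E\<close> contains disjoint balls of radius \<open>r/N\<close>
  centred on \<open>E\<close> of larger total \<open>\<psi>\<close>, so the ratio of \<open>\<integral> g\<^sup>p\<close> to \<open>\<psi>\<close> drops by a fixed factor on one of
  them. Iterating gives a geometric decay, and by completeness the centres converge in \<open>E\<close>.
  This greedy choice replaces a lower bound for the Hausdorff content of \<open>E\<close>.
\<close>

section \<open>Volume comparison and separated sets under doubling\<close>

locale doubling_measure =
  fixes \<mu> :: "'a::metric_space measure" and D :: real
  assumes sets_eq_borel: "sets \<mu> = sets borel"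
    and ball_pos: "0 < r \<Longrightarrow> 0 < emeasure \<mu> (ball x r)"
    and ball_finite: "0 < r \<Longrightarrow> emeasure \<mu> (ball x r) < \<infinity>"
    and D_ge_1: "1 \<le> D"
    and doubling_ball: "0 < r \<Longrightarrow> measure \<mu> (ball x (2 * r)) \<le> D * measure \<mu> (ball x r)"
begin

lemma open_in_sets: "open S \<Longrightarrow> S \<in> sets \<mu>"
  by (simp add: sets_eq_borel)

lemma emeasure_ball: "0 < r \<Longrightarrow> emeasure \<mu> (ball x r) = ennreal (measure \<mu> (ball x r))"
  using ball_finite[of r x] by (simp add: emeasure_eq_ennreal_measure less_top)

lemma measure_ball_pos: "0 < r \<Longrightarrow> 0 < measure \<mu> (ball x r)"
  using ball_pos[of r x] emeasure_ball[of r x] by (simp add: zero_less_measure_iff)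

lemma measure_mono_ball:
  assumes "0 < r" "S \<subseteq> ball x r"
  shows "measure \<mu> S \<le> measure \<mu> (ball x r)"
proof (cases "S \<in> sets \<mu>")
  case True
  then show ?thesis
    using assms ball_finite[OF assms(1), of x]
    by (intro measure_mono_fmeasurable) (auto simp: fmeasurable_def open_in_sets)
qed (simp add: measure_notin_sets)

lemma measure_ball_pow:
  assumes "0 < r"
  shows "measure \<mu> (ball x (2 ^ n * r)) \<le> D ^ n * measure \<mu> (ball x r)"
proof (induction n)
  case (Suc n)
  have "measure \<mu> (ball x (2 ^ Suc n * r)) \<le> D * measure \<mu> (ball x (2 ^ n * r))"
    using doubling_ball[of "2 ^ n * r" x] assms by (simp add: mult.assoc)
  also have "\<dots> \<le> D * (D ^ n * measure \<mu> (ball x r))"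
    using Suc D_ge_1 by (intro mult_left_mono) auto
  finally show ?case by (simp add: mult.assoc)
qed simp

lemma measure_ball_le:
  assumes "0 < r" "S \<subseteq> ball x (2 ^ n * r)"
  shows "measure \<mu> S \<le> D ^ n * measure \<mu> (ball x r)"
  using measure_mono_ball[OF _ assms(2)] measure_ball_pow[OF assms(1), of x n] assms(1) by force

text \<open>Balls of radius \<open>r\<close> around the points of a \<open>2r\<close>-separated set
  are disjoint, and doubling makes each of them at least a fixed fraction of
  \<open>ball w (R + r)\<close>. This bounds the cardinality, and a separated set of greatest
  cardinality cannot be enlarged, which is the covering property.\<close>

lemma maximal_separated:
  fixes w :: 'a
  assumes F: "F \<subseteq> ball w R" and r: "0 < r" and R: "0 < R"
  obtains T where "T \<subseteq> F" "finite T"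
    "\<And>a b. a \<in> T \<Longrightarrow> b \<in> T \<Longrightarrow> a \<noteq> b \<Longrightarrow> 2 * r \<le> dist a b"
    "\<And>y. y \<in> F \<Longrightarrow> \<exists>a\<in>T. dist a y < 2 * r"
proof -
  define sep where "sep T \<longleftrightarrow> T \<subseteq> F \<and> finite T \<and> (\<forall>a\<in>T. \<forall>b\<in>T. a \<noteq> b \<longrightarrow> 2 * r \<le> dist a b)" for T
  \<comment> \<open>A point of \<open>ball w R\<close> and one of \<open>ball w (R + r)\<close> are
    less than \<open>2 * R + r\<close> apart, so radius \<open>2 ^ n * r\<close> around any point of
    the separated set captures the whole larger ball.\<close>
  obtain n where n: "(2 * R + r) / r < 2 ^ n"
    using real_arch_pow[of 2 "(2 * R + r) / r"] by auto
  define m where "m = measure \<mu> (ball w (R + r))"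
  have m: "0 < m" unfolding m_def using r R by (intro measure_ball_pos) auto
  have bound: "card T \<le> nat \<lceil>D ^ n\<rceil>" if T: "sep T" for T
  proof -
    have fin: "finite T" using T by (simp add: sep_def)
    have disj: "disjoint_family_on (\<lambda>a. ball a r) T"
      unfolding disjoint_family_on_def
    proof (intro ballI impI)
      fix a b assume "a \<in> T" "b \<in> T" "a \<noteq> b"
      then have "2 * r \<le> dist a b" using T by (auto simp: sep_def)
      then show "ball a r \<inter> ball b r = {}" by (intro disjoint_ballI) simp
    qed
    have each: "m \<le> D ^ n * measure \<mu> (ball a r)" if "a \<in> T" for a
      unfolding m_def
    proof (rule measure_ball_le[OF r], rule subsetI)
      fix v assume "v \<in> ball w (R + r)"
      moreover have "a \<in> ball w R" using that T F by (auto simp: sep_def)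
      moreover have "2 * R + r < 2 ^ n * r" using n r by (simp add: field_simps)
      ultimately show "v \<in> ball a (2 ^ n * r)"
        using dist_triangle3[of a v w] by auto
    qed
    have "real (card T) * m = (\<Sum>a\<in>T. m)" by simp
    also have "\<dots> \<le> (\<Sum>a\<in>T. D ^ n * measure \<mu> (ball a r))"
      by (intro sum_mono each)
    also have "\<dots> = D ^ n * measure \<mu> (\<Union>a\<in>T. ball a r)"
      using fin disj ball_finite[OF r] unfolding sum_distrib_left[symmetric]
      by (subst measure_finite_Union) (auto simp: open_in_sets less_top)
    also have "\<dots> \<le> D ^ n * m"
    proof (rule mult_left_mono)
      have "(\<Union>a\<in>T. ball a r) \<subseteq> ball w (R + r)"
      proof safe
        fix a v assume "a \<in> T" "v \<in> ball a r"
        moreover have "a \<in> ball w R" using \<open>a \<in> T\<close> T F by (auto simp: sep_def)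
        ultimately show "v \<in> ball w (R + r)" using dist_triangle[of w v a] by auto
      qed
      then show "measure \<mu> (\<Union>a\<in>T. ball a r) \<le> m"
        unfolding m_def using r R by (intro measure_mono_ball) auto
    qed (use D_ge_1 in auto)
    finally have "real (card T) \<le> D ^ n" using m by simp
    then show ?thesis by linarith
  qed
  have "sep {}" by (simp add: sep_def)
  \<comment> \<open>\<open>ex_has_greatest_nat\<close> wants a strict bound on the cardinality,
    hence the \<open>Suc\<close>.\<close>
  then obtain T where T: "sep T" and max: "\<And>T'. sep T' \<Longrightarrow> card T' \<le> card T"
    using ex_has_greatest_nat[of sep "{}" card "Suc (nat \<lceil>D ^ n\<rceil>)"] bound by (auto simp: less_Suc_eq_le)
  show thesis
  proof
    show "T \<subseteq> F" "finite T" using T by (auto simp: sep_def)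
    show "2 * r \<le> dist a b" if "a \<in> T" "b \<in> T" "a \<noteq> b" for a b
      using T that by (auto simp: sep_def)
    show "\<exists>a\<in>T. dist a y < 2 * r" if y: "y \<in> F" for y
    proof (rule ccontr)
      assume "\<not> ?thesis"
      then have far: "\<And>a. a \<in> T \<Longrightarrow> 2 * r \<le> dist a y" by force
      then have "y \<notin> T" using r by force
      moreover have "sep (insert y T)"
        using T y far by (auto simp: sep_def dist_commute)
      ultimately show False using max[of "insert y T"] T by (simp add: sep_def)
    qed
  qed
qed

section \<open>Balls centred on \<open>E\<close> with small integrals\<close>

text \<open>Pigeonhole: if every candidate ball were heavier than claimed, the sum over disjoint
  balls around a maximal separated subset of \<open>E\<close> would exceed the integral over
  \<open>ball w \<rho>\<close>, because \<open>dens\<close> forces these balls to fill at least the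
  fraction \<open>\<delta> / D ^ 3\<close> of it.\<close>

lemma light_subball:
  fixes f :: "'a \<Rightarrow> ennreal"
  assumes f: "f \<in> borel_measurable \<mu>" and w: "w \<in> E" and \<rho>: "0 < \<rho>"
    and r: "0 < r" "4 * r \<le> \<rho>" and \<delta>: "0 < \<delta>" and h: "0 < h"
    and dens: "\<delta> * measure \<mu> (ball w (\<rho> / 2)) \<le> measure \<mu> ({y. infdist y E < r} \<inter> ball w (\<rho> / 2))"
    and int: "(\<integral>\<^sup>+ z \<in> ball w \<rho>. f z \<partial>\<mu>) \<le> ennreal (h * measure \<mu> (ball w \<rho>))"
  shows "\<exists>e\<in>E. ball e r \<subseteq> ball w \<rho> \<and>
    (\<integral>\<^sup>+ z \<in> ball e r. f z \<partial>\<mu>) \<le> ennreal (h * (D ^ 3 / \<delta>) * measure \<mu> (ball e r))"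
proof (rule ccontr)
  assume contr: "\<not> ?thesis"
  \<comment> \<open>The enlarged radius \<open>\<rho> / 2 + r\<close> admits every point of
    \<open>E\<close> within \<open>r\<close> of the half ball; as \<open>4 * r \<le> \<rho>\<close>,
    the balls of radius \<open>r\<close> around the net still lie in
    \<open>ball w \<rho>\<close>.\<close>
  obtain T where T: "T \<subseteq> E \<inter> ball w (\<rho> / 2 + r)" "finite T"
    and sep: "\<And>a b. a \<in> T \<Longrightarrow> b \<in> T \<Longrightarrow> a \<noteq> b \<Longrightarrow> 2 * r \<le> dist a b"
    and cov: "\<And>y. y \<in> E \<inter> ball w (\<rho> / 2 + r) \<Longrightarrow> \<exists>a\<in>T. dist a y < 2 * r"
    using maximal_separated[of "E \<inter> ball w (\<rho> / 2 + r)" w "\<rho> / 2 + r" r] r \<rho> by auto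
  have disj: "disjoint_family_on (\<lambda>a. ball a r) T"
    unfolding disjoint_family_on_def
  proof (intro ballI impI)
    fix a b assume "a \<in> T" "b \<in> T" "a \<noteq> b"
    then show "ball a r \<inter> ball b r = {}" using sep by (intro disjoint_ballI) force
  qed
  have sub: "ball a r \<subseteq> ball w \<rho>" if "a \<in> T" for a
  proof
    fix v assume "v \<in> ball a r"
    moreover have "a \<in> ball w (\<rho> / 2 + r)" using that T by auto
    ultimately show "v \<in> ball w \<rho>" using dist_triangle[of w v a] r by auto
  qed
  \<comment> \<open>The integrals are finite, so the strict comparison can be summed in the
    reals.\<close>
  define I where "I a = enn2real (\<integral>\<^sup>+ z \<in> ball a r. f z \<partial>\<mu>)" for a
  have I: "(\<integral>\<^sup>+ z \<in> ball a r. f z \<partial>\<mu>) = ennreal (I a)" if "a \<in> T" for a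
  proof -
    have "(\<integral>\<^sup>+ z \<in> ball a r. f z \<partial>\<mu>) \<le> (\<integral>\<^sup>+ z \<in> ball w \<rho>. f z \<partial>\<mu>)"
      using sub[OF that] by (intro nn_integral_mono) (auto simp: indicator_def)
    then have "(\<integral>\<^sup>+ z \<in> ball a r. f z \<partial>\<mu>) < top"
      using int by (meson ennreal_less_top order_le_less_trans)
    then show ?thesis unfolding I_def by (simp add: less_top)
  qed
  have Ige: "h * (D ^ 3 / \<delta>) * measure \<mu> (ball a r) < I a" if "a \<in> T" for a
  proof -
    have "\<not> (\<integral>\<^sup>+ z \<in> ball a r. f z \<partial>\<mu>) \<le> ennreal (h * (D ^ 3 / \<delta>) * measure \<mu> (ball a r))"
      using contr that T sub by blast
    then show ?thesis unfolding I[OF that] using h D_ge_1 \<delta> by (simp add: ennreal_le_iff2 not_le)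
  qed
  have "(\<Sum>a\<in>T. ennreal (I a)) = (\<Sum>a\<in>T. \<integral>\<^sup>+ z \<in> ball a r. f z \<partial>\<mu>)"
    using I by simp
  also have "\<dots> = (\<integral>\<^sup>+ z. (\<Sum>a\<in>T. f z * indicator (ball a r) z) \<partial>\<mu>)"
    using f by (intro nn_integral_sum[symmetric] borel_measurable_times_ennreal borel_measurable_indicator)
      (auto simp: open_in_sets)
  also have "\<dots> = (\<integral>\<^sup>+ z \<in> (\<Union>a\<in>T. ball a r). f z \<partial>\<mu>)"
    using T disj by (simp add: sum_distrib_left[symmetric] indicator_UN_disjoint)
  also have "\<dots> \<le> (\<integral>\<^sup>+ z \<in> ball w \<rho>. f z \<partial>\<mu>)"
  proof (intro nn_integral_mono mult_left_mono)
    fix z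
    have "(\<Union>a\<in>T. ball a r) \<subseteq> ball w \<rho>" using sub by blast
    then show "indicator (\<Union>a\<in>T. ball a r) z \<le> (indicator (ball w \<rho>) z :: ennreal)"
      unfolding indicator_def by (simp add: subset_iff del: mem_ball)
  qed simp
  also note int
  finally have le: "(\<Sum>a\<in>T. I a) \<le> h * measure \<mu> (ball w \<rho>)"
    using h by (simp add: sum_ennreal I_def)
  \<comment> \<open>The power \<open>D ^ 3\<close> is assembled here: one factor for halving \<rho>,
    two for shrinking the covering balls from \<open>4 * r\<close> to the disjoint ones of radius
    \<open>r\<close>.\<close>
  have "\<delta> * measure \<mu> (ball w \<rho>) \<le> \<delta> * (D * measure \<mu> (ball w (\<rho> / 2)))"
    using doubling_ball[of "\<rho> / 2" w] \<rho> \<delta> by simp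
  also have "\<dots> \<le> D * measure \<mu> ({y. infdist y E < r} \<inter> ball w (\<rho> / 2))"
    using mult_left_mono[OF dens, of D] D_ge_1 by (simp add: mult_ac)
  \<comment> \<open>A point of the neighbourhood is within \<open>r\<close> of some \<open>e\<close>
    in \<open>E\<close>, and \<open>e\<close> is within \<open>2 * r\<close> of the net;
    \<open>3 * r\<close> is rounded up to \<open>4 * r\<close> for doubling.\<close>
  also have "\<dots> \<le> D * measure \<mu> (\<Union>a\<in>T. ball a (2\<^sup>2 * r))"
  proof (intro mult_left_mono measure_mono_fmeasurable)
    show "{y. infdist y E < r} \<inter> ball w (\<rho> / 2) \<subseteq> (\<Union>a\<in>T. ball a (2\<^sup>2 * r))"
    proof safe
      fix y assume y: "infdist y E < r" "y \<in> ball w (\<rho> / 2)"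
      then obtain e where e: "e \<in> E" "dist y e < r"
        using w infdist_notempty[of E y] cINF_less_iff[of E "dist y" r]
        by (force simp: bdd_below_def intro: zero_le_dist)
      then have "e \<in> ball w (\<rho> / 2 + r)" using y dist_triangle[of w e y] by auto
      then obtain a where "a \<in> T" "dist a e < 2 * r" using cov e by blast
      then show "y \<in> (\<Union>a\<in>T. ball a (2\<^sup>2 * r))"
        using e dist_triangle[of a y e] r by (auto simp: dist_commute intro!: bexI[of _ a])
    qed
    have "open {y. infdist y E < r}"
      by (intro open_Collect_less continuous_intros)
    then show "{y. infdist y E < r} \<inter> ball w (\<rho> / 2) \<in> sets \<mu>"
      by (intro open_in_sets open_Int open_ball)
    show "(\<Union>a\<in>T. ball a (2\<^sup>2 * r)) \<in> fmeasurable \<mu>"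
      using T ball_finite[of "2\<^sup>2 * r"] r
      by (intro fmeasurable.finite_UN) (auto simp: fmeasurable_def open_in_sets)
  qed (use D_ge_1 in auto)
  also have "\<dots> \<le> D * (\<Sum>a\<in>T. measure \<mu> (ball a (2\<^sup>2 * r)))"
    using T D_ge_1 by (intro mult_left_mono measure_UNION_le) (auto simp: open_in_sets)
  also have "\<dots> \<le> D * (\<Sum>a\<in>T. D\<^sup>2 * measure \<mu> (ball a r))"
    using measure_ball_pow[OF r(1), of _ 2] D_ge_1 by (intro mult_left_mono sum_mono) auto
  also have "\<dots> = D ^ 3 * (\<Sum>a\<in>T. measure \<mu> (ball a r))"
    by (simp add: sum_distrib_left[symmetric] power2_eq_square power3_eq_cube)
  finally have ge: "\<delta> * measure \<mu> (ball w \<rho>) \<le> D ^ 3 * (\<Sum>a\<in>T. measure \<mu> (ball a r))" .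
  \<comment> \<open>An empty net would make \<open>ball w \<rho>\<close> a null set; nonemptiness
    makes the next sum comparison strict.\<close>
  then have "T \<noteq> {}" using measure_ball_pos[OF \<rho>, of w] \<delta> by (auto simp: mult_le_0_iff)
  then have "(\<Sum>a\<in>T. h * (D ^ 3 / \<delta>) * measure \<mu> (ball a r)) < (\<Sum>a\<in>T. I a)"
    using T Ige by (intro sum_strict_mono) auto
  also note le
  also have "h * measure \<mu> (ball w \<rho>) \<le> h * (D ^ 3 / \<delta>) * (\<Sum>a\<in>T. measure \<mu> (ball a r))"
    using mult_left_mono[OF ge, of "h / \<delta>"] h \<delta> by (simp add: field_simps)
  finally show False by (simp add: sum_distrib_left)
qed

text \<open>Each passage to a radius smaller by the factor \<open>N\<close> multiplies the bound on
  the mean by \<open>D ^ 3 / \<delta>\<close>. Nesting and shrinking radii make the centres Cauchy,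
  so completeness and closedness of \<open>E\<close> place the limit in \<open>E\<close>.\<close>

lemma light_nested_balls:
  fixes f :: "'a \<Rightarrow> ennreal"
  assumes f: "f \<in> borel_measurable \<mu>" and E: "closed E" and compl: "complete (UNIV :: 'a set)"
    and w0: "w0 \<in> E" and \<rho>: "0 < \<rho>" and N: "4 \<le> N" and \<delta>: "0 < \<delta>" and h: "0 < h"
    and dens: "\<And>w r. w \<in> E \<Longrightarrow> 0 < r \<Longrightarrow> r \<le> \<rho> \<Longrightarrow>
      \<delta> * measure \<mu> (ball w (r / 2)) \<le> measure \<mu> ({y. infdist y E < r / N} \<inter> ball w (r / 2))"
    and int: "(\<integral>\<^sup>+ z \<in> ball w0 \<rho>. f z \<partial>\<mu>) \<le> ennreal (h * measure \<mu> (ball w0 \<rho>))"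
  obtains w l where "w 0 = w0" "w \<longlonglongrightarrow> l" "l \<in> E"
    "\<And>k. ball (w (Suc k)) (\<rho> / N ^ Suc k) \<subseteq> ball (w k) (\<rho> / N ^ k)"
    "\<And>k. (\<integral>\<^sup>+ z \<in> ball (w k) (\<rho> / N ^ k). f z \<partial>\<mu>) \<le>
      ennreal (h * (D ^ 3 / \<delta>) ^ k * measure \<mu> (ball (w k) (\<rho> / N ^ k)))"
proof -
  \<comment> \<open>The clause for \<open>k = 0\<close> pins the first centre, which dependent
    choice alone would leave free.\<close>
  define P where "P k x \<longleftrightarrow> x \<in> E \<and> (k = 0 \<longrightarrow> x = w0) \<and>
    (\<integral>\<^sup>+ z \<in> ball x (\<rho> / N ^ k). f z \<partial>\<mu>) \<le>
      ennreal (h * (D ^ 3 / \<delta>) ^ k * measure \<mu> (ball x (\<rho> / N ^ k)))" for k :: nat and x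
  have "\<exists>w. \<forall>k. P k (w k) \<and> ball (w (Suc k)) (\<rho> / N ^ Suc k) \<subseteq> ball (w k) (\<rho> / N ^ k)"
  proof (rule dependent_nat_choice)
    show "\<exists>x. P 0 x" using w0 int by (auto simp: P_def)
  next
    fix x k assume x: "P k x"
    define r where "r = \<rho> / N ^ k"
    have r: "0 < r" "r \<le> \<rho>"
      using \<rho> N one_le_power[of N k] by (auto simp: r_def divide_le_eq)
    have "\<exists>e\<in>E. ball e (r / N) \<subseteq> ball x r \<and>
        (\<integral>\<^sup>+ z \<in> ball e (r / N). f z \<partial>\<mu>) \<le>
          ennreal (h * (D ^ 3 / \<delta>) ^ k * (D ^ 3 / \<delta>) * measure \<mu> (ball e (r / N)))"
    proof (rule light_subball[OF f _ r(1)])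
      show "x \<in> E" using x by (simp add: P_def)
      then show "\<delta> * measure \<mu> (ball x (r / 2)) \<le>
          measure \<mu> ({y. infdist y E < r / N} \<inter> ball x (r / 2))"
        by (rule dens[OF _ r])
      show "0 < r / N" using r N by simp
      have "r * 4 \<le> r * N" using r N by (intro mult_left_mono) auto
      then show "4 * (r / N) \<le> r" using N by (simp add: divide_le_eq mult.commute)
      show "0 < h * (D ^ 3 / \<delta>) ^ k" using h \<delta> D_ge_1 by simp
      show "(\<integral>\<^sup>+ z \<in> ball x r. f z \<partial>\<mu>) \<le> ennreal (h * (D ^ 3 / \<delta>) ^ k * measure \<mu> (ball x r))"
        using x by (simp add: P_def r_def)
    qed (rule \<delta>)
    moreover have "r / N = \<rho> / N ^ Suc k" by (simp add: r_def mult.commute)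
    ultimately show "\<exists>y. P (Suc k) y \<and> ball y (\<rho> / N ^ Suc k) \<subseteq> ball x (\<rho> / N ^ k)"
      unfolding P_def r_def[symmetric] by (auto simp: mult_ac)
  qed
  then obtain w where w: "\<And>k. P k (w k)"
    and nest: "\<And>k. ball (w (Suc k)) (\<rho> / N ^ Suc k) \<subseteq> ball (w k) (\<rho> / N ^ k)"
    by blast
  have \<rho>k: "0 < \<rho> / N ^ k" for k using \<rho> N by simp
  have near: "w n \<in> ball (w k) (\<rho> / N ^ k)" if "k \<le> n" for k n
  proof -
    have "ball (w n) (\<rho> / N ^ n) \<subseteq> ball (w k) (\<rho> / N ^ k)"
      using lift_Suc_antimono_le[of "\<lambda>k. ball (w k) (\<rho> / N ^ k)"] nest that by blast
    then show ?thesis using \<rho>k[of n] centre_in_ball by blast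
  qed
  have \<rho>lim: "(\<lambda>k. \<rho> / N ^ k) \<longlonglongrightarrow> 0"
    using LIMSEQ_realpow_zero[of "1 / N"] N tendsto_mult_right_zero[of "\<lambda>k. (1 / N) ^ k" sequentially \<rho>]
    by (simp add: power_divide)
  have "Cauchy w"
  proof (rule metric_CauchyI)
    fix e :: real assume "0 < e"
    then have "\<forall>\<^sub>F k in sequentially. \<rho> / N ^ k < e / 2"
      using order_tendstoD(2)[OF \<rho>lim, of "e / 2"] by simp
    then obtain M where M: "\<rho> / N ^ M < e / 2" by (auto simp: eventually_sequentially)
    have "dist (w m) (w n) < e" if "M \<le> m" "M \<le> n" for m n
      using near[OF that(1)] near[OF that(2)] M dist_triangle3[of "w m" "w n" "w M"]
      unfolding mem_ball by linarith
    then show "\<exists>M. \<forall>m\<ge>M. \<forall>n\<ge>M. dist (w m) (w n) < e" by blast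
  qed
  then obtain l where l: "w \<longlonglongrightarrow> l" using compl by (auto simp: complete_def)
  have "l \<in> E"
    using closed_sequentially[OF E _ l] w by (auto simp: P_def)
  then show thesis using that[of w l] w nest l by (auto simp: P_def)
qed

text \<open>Fatou's lemma along a convergent sequence shows that sublevel sets are closed, so the
  integral is lower semicontinuous in \<open>y\<close>. Openness of the superlevel sets survives the
  arbitrary unions in \<open>max_osc_measurable\<close>.\<close>

lemma lsc_nn_integral_powr_diff:
  fixes u :: "'a \<Rightarrow> real"
  assumes u: "continuous_on UNIV u" and S: "S \<in> sets \<mu>" and t: "0 < t"
  shows "open {y. c < (\<integral>\<^sup>+ z \<in> S. ennreal (\<bar>u y - u z\<bar> powr t) \<partial>\<mu>)}"
proof -
  let ?I = "\<lambda>y. (\<integral>\<^sup>+ z \<in> S. ennreal (\<bar>u y - u z\<bar> powr t) \<partial>\<mu>)"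
  have um: "u \<in> borel_measurable \<mu>"
    using borel_measurable_continuous_onI[OF u] sets_eq_borel
    by (simp cong: measurable_cong_sets)
  have "closed {y. ?I y \<le> c}"
    unfolding closed_sequential_limits
  proof safe
    fix y l assume le: "\<forall>n. y n \<in> {y. ?I y \<le> c}" and lim: "y \<longlonglongrightarrow> l"
    have ulim: "(\<lambda>n. u (y n)) \<longlonglongrightarrow> u l"
      using u lim by (auto simp: continuous_on_sequentially comp_def)
    have "(\<lambda>n. ennreal (\<bar>u (y n) - u z\<bar> powr t) * indicator S z)
        \<longlonglongrightarrow> ennreal (\<bar>u l - u z\<bar> powr t) * indicator S z" for z
    proof (cases "z \<in> S")
      case True
      have "(\<lambda>n. \<bar>u (y n) - u z\<bar> powr t) \<longlonglongrightarrow> \<bar>u l - u z\<bar> powr t"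
        by (rule tendsto_powr2) (use t in \<open>auto intro!: tendsto_intros ulim\<close>)
      then show ?thesis using True by (simp add: tendsto_ennrealI)
    qed simp
    then have "?I l = (\<integral>\<^sup>+ z. liminf (\<lambda>n. ennreal (\<bar>u (y n) - u z\<bar> powr t) * indicator S z) \<partial>\<mu>)"
      by (intro nn_integral_cong) (metis lim_imp_Liminf sequentially_bot)
    also have "\<dots> \<le> liminf (\<lambda>n. ?I (y n))"
      using um S
      by (intro nn_integral_liminf borel_measurable_times_ennreal measurable_compose[OF _ measurable_ennreal]
          powr_real_measurable borel_measurable_abs borel_measurable_diff borel_measurable_indicator)
        auto
    also have "\<dots> \<le> limsup (\<lambda>n. ?I (y n))"
      by (rule Liminf_le_Limsup) simp
    also have "\<dots> \<le> c"
      using le by (intro Limsup_bounded) auto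
    finally show "?I l \<le> c" .
  qed
  then have "open (- {y. ?I y \<le> c})" by (rule open_Compl)
  also have "- {y. ?I y \<le> c} = {y. c < ?I y}" by auto
  finally show ?thesis .
qed

end

section \<open>Powers and quotients of extended nonnegative reals\<close>

lemma power_powr:
  fixes x a :: real
  assumes "0 < x"
  shows "(x ^ k) powr a = (x powr a) ^ k"
proof -
  have "(x ^ k) powr a = (x powr a) powr real k"
    using assms by (simp add: powr_realpow[symmetric] powr_powr mult.commute)
  then show ?thesis using assms by (simp add: powr_realpow)
qed

lemma ennreal_powr_mono: "a \<le> b \<Longrightarrow> 0 \<le> e \<Longrightarrow> ennreal_powr a e \<le> ennreal_powr b e"
  unfolding ennreal_powr_def
  by (cases a; cases b) (auto simp: top_unique intro!: ennreal_leI powr_mono2)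

lemma ennreal_powr_ennreal: "0 \<le> a \<Longrightarrow> ennreal_powr (ennreal a) e = ennreal (a powr e)"
  by (simp add: ennreal_powr_def)

lemma ennreal_powr_powr:
  "ennreal_powr (ennreal_powr a e) f = ennreal_powr a (e * f)"
  by (cases a) (auto simp: ennreal_powr_def powr_powr)

lemma ennreal_powr_le_iff:
  assumes "0 < e" "0 \<le> b"
  shows "ennreal_powr a e \<le> ennreal b \<longleftrightarrow> a \<le> ennreal (b powr (1 / e))"
proof (cases a)
  case (real r)
  have "r powr e \<le> b \<longleftrightarrow> r \<le> b powr (1 / e)"
  proof
    assume "r powr e \<le> b"
    then have "(r powr e) powr (1 / e) \<le> b powr (1 / e)"
      using assms by (intro powr_mono2) auto
    then show "r \<le> b powr (1 / e)" using assms real by (simp add: powr_powr)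
  next
    assume "r \<le> b powr (1 / e)"
    then have "r powr e \<le> (b powr (1 / e)) powr e"
      using assms real by (intro powr_mono2) auto
    then show "r powr e \<le> b" using assms by (simp add: powr_powr)
  qed
  then show ?thesis using real assms by (simp add: ennreal_powr_def)
next
  case top
  then show ?thesis by (simp add: ennreal_powr_def top_unique)
qed

lemma divide_le_ennreal_iff:
  fixes a b c :: ennreal
  assumes "b \<noteq> 0" "b < top"
  shows "a / b \<le> c \<longleftrightarrow> a \<le> c * b"
proof
  assume "a / b \<le> c"
  then have "a / b * b \<le> c * b" by (rule mult_right_mono) simp
  then show "a \<le> c * b" using assms by (simp add: ennreal_divide_times)
next
  assume "a \<le> c * b"
  then have "a / b \<le> c * b / b" by (rule divide_right_mono_ennreal)
  then show "a / b \<le> c" using assms by (simp add: mult_divide_eq_ennreal)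
qed

lemma divide_left_mono_ennreal:
  fixes a b c :: ennreal
  assumes "b \<le> c"
  shows "a / c \<le> a / b"
proof (cases "b = 0 \<or> c = top")
  case True
  then show ?thesis using assms by (cases "a = 0") auto
next
  case False
  then obtain x y where "b = ennreal x" "c = ennreal y" "0 < x" "x \<le> y"
    using assms by (cases b; cases c) (auto simp: top_unique)
  then show ?thesis
    by (cases a) (auto simp: divide_ennreal ennreal_top_divide intro!: ennreal_leI divide_left_mono)
qed

lemma less_divide_ennreal:
  fixes a b c :: ennreal
  shows "b \<noteq> 0 \<Longrightarrow> b \<noteq> top \<Longrightarrow> c < a / b \<longleftrightarrow> c * b < a"
  using divide_le_ennreal_iff[of b a c] by (simp add: not_le[symmetric] less_top)

lemma borel_measurable_ennreal_powr [measurable]: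
  "f \<in> borel_measurable M \<Longrightarrow> (\<lambda>x. ennreal_powr (f x) e) \<in> borel_measurable M"
  unfolding ennreal_powr_def
proof (rule measurable_If)
  assume f: "f \<in> borel_measurable M"
  have "f -` {\<infinity>} \<inter> space M \<in> sets M" using f by (rule measurable_sets) simp
  also have "f -` {\<infinity>} \<inter> space M = {x \<in> space M. f x = \<infinity>}" by auto
  finally show "{x \<in> space M. f x = \<infinity>} \<in> sets M" .
  show "(\<lambda>x. ennreal (enn2real (f x) powr e)) \<in> borel_measurable M"
    by (intro measurable_compose[OF _ measurable_ennreal] powr_real_measurable
        measurable_compose[OF f borel_measurable_enn2real]) auto
qed auto

section \<open>A measurable minorant of the fractional gradient\<close>

locale fractional_oscillation = doubling_measure \<mu> D
  for \<mu> :: "'a::metric_space measure" and D :: real +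
  fixes u :: "'a \<Rightarrow> real" and A :: "'a set" and s t p :: real
  assumes cont: "continuous_on UNIV u"
    and s_pos: "0 < s" and t_ge_1: "1 \<le> t" and p_ge_1: "1 \<le> p"
begin

text \<open>For distinct \<open>y\<close>, \<open>z\<close> in \<open>ball w \<rho>\<close> the
  divisor dominates the kernel denominator \<open>dist y z powr (s * t)\<close> times the measure of
  \<open>ball y (dist y z)\<close>. If the ball lies in \<open>A\<close>, the quotient therefore
  bounds the \<open>t\<close>-th power of the gradient from below, while its numerator is a plain
  integral, lower semicontinuous in \<open>y\<close>.\<close>

definition osc :: "'a \<Rightarrow> real \<Rightarrow> 'a \<Rightarrow> ennreal" where
  "osc w \<rho> y = (\<integral>\<^sup>+ z \<in> ball w \<rho>. ennreal (\<bar>u y - u z\<bar> powr t) \<partial>\<mu>) /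
     ennreal (D\<^sup>2 * (2 * \<rho>) powr (s * t) * measure \<mu> (ball w \<rho>))"

text \<open>A noncentred maximal function of the oscillation; confining the balls to
  \<open>A\<close> makes it vanish off \<open>A\<close>.\<close>

definition max_osc :: "'a \<Rightarrow> ennreal" where
  "max_osc y = (SUP (w, \<rho>) \<in> {(w, \<rho>). 0 < \<rho> \<and> y \<in> ball w \<rho> \<and> ball w \<rho> \<subseteq> A}. osc w \<rho> y)"

text \<open>
  A lower semicontinuous minorant of the \<open>p\<close>-th power of the fractional gradient. The gradient
  itself is not known to be measurable, since the space is not assumed to be second countable.
\<close>
definition energy :: "'a \<Rightarrow> ennreal" where
  "energy y = ennreal_powr (max_osc y) (p / t)"

lemma u_measurable [measurable]: "u \<in> borel_measurable \<mu>"
  using borel_measurable_continuous_onI[OF cont] sets_eq_borel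
  by (simp cong: measurable_cong_sets)

lemma ball_sets [measurable]: "ball x r \<in> sets \<mu>"
  by (simp add: open_in_sets)

text \<open>Superlevel sets are unions of open sets, one for each admissible ball. The family may be
  uncountable, so openness does the work of countability.\<close>

lemma max_osc_measurable [measurable]: "max_osc \<in> borel_measurable \<mu>"
proof (rule borel_measurableI_greater)
  fix c
  have op: "open {y. c < osc w \<rho> y}" if "0 < \<rho>" for w \<rho>
  proof -
    define k where "k = ennreal (D\<^sup>2 * (2 * \<rho>) powr (s * t) * measure \<mu> (ball w \<rho>))"
    have k: "k \<noteq> 0" "k \<noteq> \<infinity>"
      using that D_ge_1 measure_ball_pos[OF that, of w] by (auto simp: k_def)
    have "{y. c < osc w \<rho> y} =
        {y. c * k < (\<integral>\<^sup>+ z \<in> ball w \<rho>. ennreal (\<bar>u y - u z\<bar> powr t) \<partial>\<mu>)}"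
      unfolding osc_def k_def[symmetric] using k by (simp add: less_divide_ennreal)
    then show ?thesis
      using lsc_nn_integral_powr_diff[OF cont ball_sets, of t "c * k"] t_ge_1 by simp
  qed
  have "{y \<in> space \<mu>. c < max_osc y} =
      (\<Union>(w, \<rho>) \<in> {(w, \<rho>). 0 < \<rho> \<and> ball w \<rho> \<subseteq> A}. ball w \<rho> \<inter> {y. c < osc w \<rho> y})"
    using sets_eq_imp_space_eq[OF sets_eq_borel] by (auto simp: max_osc_def less_SUP_iff) blast
  also have "open \<dots>"
    using op by (intro open_UN ballI) (auto intro!: open_Int)
  finally show "{y \<in> space \<mu>. c < max_osc y} \<in> sets \<mu>"
    by (rule open_in_sets)
qed

lemma energy_measurable [measurable]: "energy \<in> borel_measurable \<mu>"
  unfolding energy_def by measurable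

lemma osc_le_kernel:
  assumes \<rho>: "0 < \<rho>" and y: "y \<in> ball w \<rho>" and sub: "ball w \<rho> \<subseteq> A"
  shows "osc w \<rho> y \<le> (\<integral>\<^sup>+ z \<in> A. ennreal (\<bar>u y - u z\<bar> powr t) /
          (ennreal (dist y z powr (s * t)) * emeasure \<mu> (ball y (dist y z))) \<partial>\<mu>)"
proof -
  define K where "K = D\<^sup>2 * (2 * \<rho>) powr (s * t) * measure \<mu> (ball w \<rho>)"
  have K: "0 < K"
    using \<rho> D_ge_1 measure_ball_pos[OF \<rho>, of w] by (simp add: K_def)
  have "osc w \<rho> y = (\<integral>\<^sup>+ z \<in> ball w \<rho>. ennreal (\<bar>u y - u z\<bar> powr t) / ennreal K \<partial>\<mu>)"
    unfolding osc_def K_def[symmetric]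
    by (subst nn_integral_divide[symmetric])
      (auto intro!: nn_integral_cong borel_measurable_times_ennreal measurable_compose[OF _ measurable_ennreal]
        simp: ennreal_divide_times divide_ennreal_def mult_ac)
  also have "\<dots> \<le> (\<integral>\<^sup>+ z \<in> A. ennreal (\<bar>u y - u z\<bar> powr t) /
          (ennreal (dist y z powr (s * t)) * emeasure \<mu> (ball y (dist y z))) \<partial>\<mu>)"
  proof (rule nn_integral_mono)
    fix z
    show "ennreal (\<bar>u y - u z\<bar> powr t) / ennreal K * indicator (ball w \<rho>) z \<le>
       ennreal (\<bar>u y - u z\<bar> powr t) /
          (ennreal (dist y z powr (s * t)) * emeasure \<mu> (ball y (dist y z))) * indicator A z"
    \<comment> \<open>At \<open>z = y\<close> the left side is zero because
      \<open>0 powr t = 0\<close>, and outside the ball because of the indicator.\<close>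
    proof (cases "z \<in> ball w \<rho> \<and> z \<noteq> y")
      case True
      define r where "r = dist y z"
      have r: "0 < r" "r < 2 * \<rho>"
        using True y dist_triangle3[of y z w]
        by (auto simp: r_def)
      \<comment> \<open>\<open>dist w y < \<rho>\<close> and \<open>r < 2 * \<rho>\<close> keep the
        ball within radius \<open>3 * \<rho>\<close>; two doublings cover this, hence
        \<open>D\<^sup>2\<close> in \<open>osc\<close>.\<close>
      have "ball y r \<subseteq> ball w (2 ^ 2 * \<rho>)"
      proof
        fix v assume "v \<in> ball y r"
        then show "v \<in> ball w (2 ^ 2 * \<rho>)"
          using r y dist_triangle[of w v y] by auto
      qed
      then have "measure \<mu> (ball y r) \<le> D\<^sup>2 * measure \<mu> (ball w \<rho>)"
        by (rule measure_ball_le[OF \<rho>])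
      moreover have "r powr (s * t) \<le> (2 * \<rho>) powr (s * t)"
        using r s_pos t_ge_1 by (intro powr_mono2) auto
      ultimately have "r powr (s * t) * measure \<mu> (ball y r) \<le>
          (2 * \<rho>) powr (s * t) * (D\<^sup>2 * measure \<mu> (ball w \<rho>))"
        by (intro mult_mono) auto
      then have "ennreal (r powr (s * t)) * emeasure \<mu> (ball y r) \<le> ennreal K"
        using emeasure_ball[OF r(1), of y]
        by (simp add: K_def ennreal_mult[symmetric] ennreal_leI mult_ac)
      then have "ennreal (\<bar>u y - u z\<bar> powr t) / ennreal K \<le>
          ennreal (\<bar>u y - u z\<bar> powr t) / (ennreal (r powr (s * t)) * emeasure \<mu> (ball y r))"
        by (rule divide_left_mono_ennreal)
      then show ?thesis
        using True sub by (auto simp: r_def indicator_def)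
    qed (auto simp: indicator_def)
  qed
  finally show ?thesis .
qed

lemma energy_le_frac_grad:
  "energy y \<le> indicator A y * ennreal_powr (frac_grad \<mu> u s t A y) p"
proof -
  define I where "I = (\<integral>\<^sup>+ z \<in> A. ennreal (\<bar>u y - u z\<bar> powr t) /
          (ennreal (dist y z powr (s * t)) * emeasure \<mu> (ball y (dist y z))) \<partial>\<mu>)"
  have fg: "ennreal_powr (frac_grad \<mu> u s t A y) p = ennreal_powr I (p / t)"
    unfolding frac_grad_def I_def[symmetric] by (simp add: ennreal_powr_powr)
  show ?thesis
  proof (cases "y \<in> A")
    case True
    have "max_osc y \<le> I"
      unfolding max_osc_def I_def by (rule SUP_least) (auto intro: osc_le_kernel)
    then show ?thesis
      using True p_ge_1 t_ge_1 unfolding energy_def fg by (simp add: ennreal_powr_mono)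
  next
    case False
    \<comment> \<open>Off \<open>A\<close> the supremum runs over the empty set and is
      \<open>0\<close> in \<open>ennreal\<close>.\<close>
    then have "{(w, \<rho>). 0 < \<rho> \<and> y \<in> ball w \<rho> \<and> ball w \<rho> \<subseteq> A} = {}" by auto
    then have "max_osc y = 0" unfolding max_osc_def by (metis SUP_empty bot_ennreal)
    then show ?thesis by (simp add: energy_def ennreal_powr_def)
  qed
qed

section \<open>Chebyshev's inequality and chains of good points\<close>

lemma osc_le_of_energy:
  assumes \<rho>: "0 < \<rho>" and y: "y \<in> ball w \<rho>" and sub: "ball w \<rho> \<subseteq> A"
    and e: "energy y \<le> ennreal h" and h: "0 \<le> h"
  shows "(\<integral>\<^sup>+ z \<in> ball w \<rho>. ennreal (\<bar>u y - u z\<bar> powr t) \<partial>\<mu>)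
     \<le> ennreal (h powr (t / p) * (D\<^sup>2 * (2 * \<rho>) powr (s * t) * measure \<mu> (ball w \<rho>)))"
proof -
  define K where "K = D\<^sup>2 * (2 * \<rho>) powr (s * t) * measure \<mu> (ball w \<rho>)"
  have K: "0 < K"
    using \<rho> D_ge_1 measure_ball_pos[OF \<rho>, of w] by (simp add: K_def)
  have "osc w \<rho> y \<le> max_osc y"
    unfolding max_osc_def using \<rho> y sub by (intro SUP_upper2[of "(w, \<rho>)"]) auto
  also have "\<dots> \<le> ennreal (h powr (t / p))"
    using e h p_ge_1 t_ge_1 ennreal_powr_le_iff[of "p / t" h "max_osc y"] by (simp add: energy_def)
  finally show ?thesis
    using K unfolding osc_def K_def[symmetric]
    by (subst (asm) divide_le_ennreal_iff) (auto simp: ennreal_mult)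
qed

text \<open>Chebyshev twice: the points where \<open>u\<close> is far from \<open>u y\<close> and
  those where \<open>energy\<close> exceeds \<open>4 * h'\<close> each fill at most a quarter of
  \<open>ball v r\<close>, so some point avoids both sets.\<close>

lemma nearby_good_point:
  assumes \<rho>: "0 < \<rho>" and y: "y \<in> ball w \<rho>" and sub: "ball w \<rho> \<subseteq> A"
    and S: "0 < r" "ball v r \<subseteq> ball w \<rho>"
    and L: "measure \<mu> (ball w \<rho>) \<le> L * measure \<mu> (ball v r)"
    and e: "energy y \<le> ennreal (4 * h)" and h: "0 < h"
    and h': "0 < h'"
    and int: "(\<integral>\<^sup>+ z \<in> ball v r. energy z \<partial>\<mu>) \<le> ennreal (h' * measure \<mu> (ball v r))"
  shows "\<exists>z\<in>ball v r. energy z \<le> ennreal (4 * h') \<and>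
    \<bar>u y - u z\<bar> \<le> (4 * L * D\<^sup>2) powr (1 / t) * 4 powr (1 / p) * 2 powr s * (\<rho> powr s * h powr (1 / p))"
proof -
  define m where "m = measure \<mu> (ball v r)"
  define l where "l = (4 * L * D\<^sup>2) powr (1 / t) * 4 powr (1 / p) * 2 powr s * (\<rho> powr s * h powr (1 / p))"
  have m: "0 < m" unfolding m_def using S(1) by (rule measure_ball_pos)
  have Lpos: "0 < L"
    using L measure_ball_pos[OF \<rho>, of w] m unfolding m_def[symmetric] by (smt (verit) zero_less_mult_iff)
  have l: "0 < l"
    using \<rho> h Lpos D_ge_1 by (auto simp: l_def)
  define c where "c = (4 * h) powr (t / p) * (D\<^sup>2 * (2 * \<rho>) powr (s * t) * (L * m))"
  have cpos: "0 < c"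
    using h D_ge_1 \<rho> Lpos m by (simp add: c_def)
  \<comment> \<open>The factors of \<open>l\<close> are chosen for this identity: \<open>c\<close>
    bounds the integral of \<open>\<bar>u y - u z\<bar> powr t\<close>, and the 4 yields the quarter
    in Chebyshev's inequality.\<close>
  have lt: "l powr t * m = 4 * c"
    using \<rho> h Lpos D_ge_1 t_ge_1 p_ge_1
    by (simp add: l_def c_def powr_mult powr_powr mult_ac)
  have "(\<integral>\<^sup>+ z \<in> ball v r. ennreal (\<bar>u y - u z\<bar> powr t) \<partial>\<mu>) \<le>
        (\<integral>\<^sup>+ z \<in> ball w \<rho>. ennreal (\<bar>u y - u z\<bar> powr t) \<partial>\<mu>)"
    using S(2) by (intro nn_integral_mono) (auto simp: indicator_def)
  also have "\<dots> \<le> ennreal ((4 * h) powr (t / p) * (D\<^sup>2 * (2 * \<rho>) powr (s * t) * measure \<mu> (ball w \<rho>)))"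
    using h by (intro osc_le_of_energy[OF \<rho> y sub e]) auto
  also have "\<dots> \<le> ennreal c"
    unfolding c_def m_def using L by (intro ennreal_leI mult_left_mono) auto
  finally have I1: "(\<integral>\<^sup>+ z \<in> ball v r. ennreal (\<bar>u y - u z\<bar> powr t) \<partial>\<mu>) \<le> ennreal c" .
  define B1 where "B1 = {z \<in> ball v r. l < \<bar>u y - u z\<bar>}"
  define B2 where "B2 = {z \<in> ball v r. ennreal (4 * h') < energy z}"
  have sp: "space \<mu> = UNIV" using sets_eq_imp_space_eq[OF sets_eq_borel] by simp
  have "ball v r \<inter> {z \<in> space \<mu>. l < \<bar>u y - u z\<bar>} \<in> sets \<mu>"
    by (intro sets.Int ball_sets) measurable
  also have "ball v r \<inter> {z \<in> space \<mu>. l < \<bar>u y - u z\<bar>} = B1"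
    unfolding sp B1_def by blast
  finally have B1m: "B1 \<in> sets \<mu>" .
  have "ball v r \<inter> {z \<in> space \<mu>. ennreal (4 * h') < energy z} \<in> sets \<mu>"
    by (intro sets.Int ball_sets) measurable
  also have "ball v r \<inter> {z \<in> space \<mu>. ennreal (4 * h') < energy z} = B2"
    unfolding sp B2_def by blast
  finally have B2m: "B2 \<in> sets \<mu>" .
  have B1_sub: "B1 \<subseteq> ball v r" and B2_sub: "B2 \<subseteq> ball v r"
    by (auto simp: B1_def B2_def)
  have fin: "emeasure \<mu> X = ennreal (measure \<mu> X)" if "X \<subseteq> ball v r" for X
    using ball_finite[OF S(1), of v] emeasure_mono[OF that ball_sets]
    by (intro emeasure_eq_ennreal_measure) (auto simp: top_unique)
  have "ennreal (l powr t) * emeasure \<mu> B1 = (\<integral>\<^sup>+ z. ennreal (l powr t) * indicator B1 z \<partial>\<mu>)"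
    by (rule nn_integral_cmult_indicator[OF B1m, symmetric])
  also have "\<dots> \<le> (\<integral>\<^sup>+ z \<in> ball v r. ennreal (\<bar>u y - u z\<bar> powr t) \<partial>\<mu>)"
    using l t_ge_1
    by (intro nn_integral_mono) (auto simp: B1_def indicator_def intro!: ennreal_leI powr_mono2)
  also note I1
  finally have "l powr t * measure \<mu> B1 \<le> l powr t * (m / 4)"
    using cpos lt by (simp add: fin[OF B1_sub] ennreal_mult[symmetric])
  then have b1: "measure \<mu> B1 \<le> m / 4"
    using l by (subst (asm) mult_le_cancel_left_pos) auto
  have "ennreal (4 * h') * emeasure \<mu> B2 = (\<integral>\<^sup>+ z. ennreal (4 * h') * indicator B2 z \<partial>\<mu>)"
    by (rule nn_integral_cmult_indicator[OF B2m, symmetric])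
  also have "\<dots> \<le> (\<integral>\<^sup>+ z \<in> ball v r. energy z \<partial>\<mu>)"
    by (intro nn_integral_mono) (auto simp: B2_def indicator_def)
  also note int
  finally have "4 * h' * measure \<mu> B2 \<le> h' * m"
    using h' m by (simp add: fin[OF B2_sub] ennreal_mult[symmetric] m_def)
  then have b2: "measure \<mu> B2 \<le> m / 4" using h' by (simp add: field_simps)
  have "measure \<mu> (B1 \<union> B2) \<le> measure \<mu> B1 + measure \<mu> B2"
    using B1m B2m by (rule measure_Un_le)
  then have "B1 \<union> B2 \<noteq> ball v r"
    using b1 b2 m unfolding m_def by force
  then obtain z where "z \<in> ball v r" "z \<notin> B1" "z \<notin> B2"
    using B1_sub B2_sub by blast
  then show ?thesis
    unfolding l_def[symmetric] by (intro bexI[of _ z]) (auto simp: B1_def B2_def)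
qed

text \<open>Supplies the first point of a chain, with the same factor 4 that the chain carries
  along.\<close>

lemma good_point_exists:
  assumes r: "0 < r" and h: "0 < h"
    and int: "(\<integral>\<^sup>+ z \<in> ball v r. energy z \<partial>\<mu>) \<le> ennreal (h * measure \<mu> (ball v r))"
  shows "\<exists>z\<in>ball v r. energy z \<le> ennreal (4 * h)"
proof (rule ccontr)
  assume "\<not> ?thesis"
  then have "\<And>z. z \<in> ball v r \<Longrightarrow> ennreal (4 * h) < energy z" by force
  then have "(\<integral>\<^sup>+ z. ennreal (4 * h) * indicator (ball v r) z \<partial>\<mu>) \<le> (\<integral>\<^sup>+ z \<in> ball v r. energy z \<partial>\<mu>)"
    by (intro nn_integral_mono) (auto simp: indicator_def less_imp_le)
  also note int
  finally have "4 * h * measure \<mu> (ball v r) \<le> h * measure \<mu> (ball v r)"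
    using h by (simp add: nn_integral_cmult_indicator emeasure_ball[OF r] ennreal_mult[symmetric])
  then show False using h measure_ball_pos[OF r, of v] by simp
qed

text \<open>The constant of \<open>nearby_good_point\<close>, where \<open>L\<close> bounds the
  ratio of the measures of consecutive balls.\<close>

definition step_const :: "real \<Rightarrow> real" where
  "step_const L = (4 * L * D\<^sup>2) powr (1 / t) * 4 powr (1 / p) * 2 powr s"

text \<open>Good points picked in successive balls change \<open>u\<close> by at most the terms of a
  geometric series. They converge to the limit of the centres because the radii tend to zero, and
  continuity carries the bound over to \<open>u l\<close>.\<close>

lemma chain_bound:
  assumes \<rho>: "\<And>k. 0 < \<rho> k" and sub: "ball (w 0) (\<rho> 0) \<subseteq> A"
    and nested: "\<And>k. ball (w (Suc k)) (\<rho> (Suc k)) \<subseteq> ball (w k) (\<rho> k)"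
    and L: "\<And>k. measure \<mu> (ball (w k) (\<rho> k)) \<le> L * measure \<mu> (ball (w (Suc k)) (\<rho> (Suc k)))"
    and h: "\<And>k. 0 < h k"
    and int: "\<And>k. (\<integral>\<^sup>+ z \<in> ball (w k) (\<rho> k). energy z \<partial>\<mu>) \<le> ennreal (h k * measure \<mu> (ball (w k) (\<rho> k)))"
    and decay: "\<And>k. \<rho> k powr s * h k powr (1 / p) \<le> b * \<theta> ^ k" and \<theta>: "0 \<le> \<theta>" "\<theta> < 1"
    and lim: "w \<longlonglongrightarrow> l" "\<rho> \<longlonglongrightarrow> 0"
    and z0: "z0 \<in> ball (w 0) (\<rho> 0)" "energy z0 \<le> ennreal (4 * h 0)"
  shows "\<bar>u z0 - u l\<bar> \<le> step_const L * (b / (1 - \<theta>))"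
proof -
  have sub': "ball (w k) (\<rho> k) \<subseteq> A" for k
    using lift_Suc_antimono_le[of "\<lambda>k. ball (w k) (\<rho> k)" 0 k] nested sub by blast
  \<comment> \<open>The energy bound belongs to the invariant because the choice of the next point
    requires it at the current one; the last clause anchors the chain at \<open>z0\<close>.\<close>
  define P where "P k z \<longleftrightarrow> z \<in> ball (w k) (\<rho> k) \<and> energy z \<le> ennreal (4 * h k) \<and> (k = 0 \<longrightarrow> z = z0)" for k z
  have "\<exists>z. \<forall>k. P k (z k) \<and> \<bar>u (z k) - u (z (Suc k))\<bar> \<le> step_const L * (\<rho> k powr s * h k powr (1 / p))"
  proof (rule dependent_nat_choice)
    show "\<exists>z. P 0 z" using z0 by (auto simp: P_def)
  next
    fix z k assume z: "P k z"
    have "\<exists>z'\<in>ball (w (Suc k)) (\<rho> (Suc k)). energy z' \<le> ennreal (4 * h (Suc k)) \<and>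
        \<bar>u z - u z'\<bar> \<le> step_const L * (\<rho> k powr s * h k powr (1 / p))"
      unfolding step_const_def
      by (rule nearby_good_point[OF \<rho> _ sub' \<rho> nested L _ h h int]) (use z in \<open>auto simp: P_def\<close>)
    then show "\<exists>z'. P (Suc k) z' \<and> \<bar>u z - u z'\<bar> \<le> step_const L * (\<rho> k powr s * h k powr (1 / p))"
      unfolding P_def by blast
  qed
  then obtain z where z: "\<And>k. P k (z k)"
    and step: "\<And>k. \<bar>u (z k) - u (z (Suc k))\<bar> \<le> step_const L * (\<rho> k powr s * h k powr (1 / p))"
    by blast
  have sc: "0 \<le> step_const L" by (simp add: step_const_def)
  have b: "0 \<le> b" using decay[of 0] by (simp add: order_trans[OF _ decay[of 0, simplified]])
  have partial: "\<bar>u z0 - u (z n)\<bar> \<le> step_const L * (b / (1 - \<theta>))" for n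
  proof -
    have "\<bar>u (z 0) - u (z n)\<bar> \<le> (\<Sum>k<n. step_const L * (b * \<theta> ^ k))"
    proof (induction n)
      case (Suc n)
      have "\<bar>u (z n) - u (z (Suc n))\<bar> \<le> step_const L * (b * \<theta> ^ n)"
        using step[of n] mult_left_mono[OF decay[of n] sc] by linarith
      then show ?case using Suc by simp
    qed simp
    also have "\<dots> = step_const L * b * (\<Sum>k<n. \<theta> ^ k)" by (simp add: sum_distrib_left mult.assoc)
    also have "\<dots> \<le> step_const L * b * (1 / (1 - \<theta>))"
      using \<theta> sc b by (intro mult_left_mono) (auto simp: sum_gp_strict divide_right_mono)
    finally show ?thesis using z[of 0] by (simp add: P_def)
  qed
  have "z \<longlonglongrightarrow> l"
  proof (rule metric_LIMSEQ_I)
    fix e :: real assume "0 < e"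
    then have "\<forall>\<^sub>F k in sequentially. dist (w k) l < e / 2 \<and> \<rho> k < e / 2"
      using tendstoD[OF lim(1), of "e / 2"] order_tendstoD(2)[OF lim(2), of "e / 2"]
      by (auto intro: eventually_conj)
    then obtain M where M: "\<And>k. M \<le> k \<Longrightarrow> dist (w k) l < e / 2 \<and> \<rho> k < e / 2"
      by (auto simp: eventually_sequentially)
    have "dist (z k) l < e" if "M \<le> k" for k
      using M[OF that] z[of k] dist_triangle3[of "z k" l "w k"] by (auto simp: P_def)
    then show "\<exists>M. \<forall>k\<ge>M. dist (z k) l < e" by blast
  qed
  then have "(\<lambda>n. u (z n)) \<longlonglongrightarrow> u l"
    using cont by (auto simp: continuous_on_sequentially comp_def)
  then have "(\<lambda>n. \<bar>u z0 - u (z n)\<bar>) \<longlonglongrightarrow> \<bar>u z0 - u l\<bar>"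
    by (intro tendsto_intros)
  then show ?thesis
    by (rule LIMSEQ_le_const2) (use partial in blast)
qed

section \<open>The estimate at a single point\<close>

text \<open>Two chains leave the same good point \<open>z\<close>: concentric balls lead to
  \<open>x\<close>, light balls to a zero of \<open>u\<close>. By \<open>small\<close>, shrinking
  the radius by \<open>2 ^ j\<close> outweighs the growth \<open>D ^ 3 / \<delta>\<close> of the
  means, with ratio at most one half.\<close>

lemma pointwise_bound:
  assumes A: "A = ball x (2 * d)" and d: "0 < d" and m: "0 < m" and \<alpha>: "\<alpha> < s"
    and int: "\<And>r. 0 < r \<Longrightarrow>
      (\<integral>\<^sup>+ z \<in> ball x r. energy z \<partial>\<mu>) \<le> ennreal (m * r powr (- \<alpha> * p) * measure \<mu> (ball x r))"
    and E: "closed E" "complete (UNIV :: 'a set)" and u0: "\<And>y. y \<in> E \<Longrightarrow> u y = 0"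
    and w0: "w0 \<in> E" "dist x w0 < 3 / 2 * d" and j: "2 \<le> j" and \<delta>: "0 < \<delta>"
    and dens: "\<And>w r. w \<in> E \<Longrightarrow> 0 < r \<Longrightarrow> r \<le> d / 4 \<Longrightarrow>
      \<delta> * measure \<mu> (ball w (r / 2)) \<le> measure \<mu> ({y. infdist y E < r / 2 ^ j} \<inter> ball w (r / 2))"
    and small: "(2 ^ j) powr (- s) * (D ^ 3 / \<delta>) powr (1 / p) \<le> 1 / 2"
  shows "\<bar>u x\<bar> \<le> step_const (D ^ (j + 4)) *
    ((1 / (1 - 2 powr (\<alpha> - s)) + 4 * D ^ 4) * ((2 * d) powr (s - \<alpha>) * m powr (1 / p)))"
proof -
  define b where "b = (2 * d) powr (s - \<alpha>) * m powr (1 / p)"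
  \<comment> \<open>The bound \<open>int\<close> at \<open>r = 2 * d\<close>, that is, a bound on
    the mean of \<open>energy\<close> over all of \<open>A\<close>.\<close>
  define h where "h = m * (2 * d) powr (- \<alpha> * p)"
  have h: "0 < h" using m d by (simp add: h_def)
  have b_h: "(2 * d) powr s * h powr (1 / p) = b"
    using m d p_ge_1 by (simp add: h_def b_def powr_mult powr_powr powr_add[symmetric] mult.left_commute)
  have b: "0 < b" using m d by (simp add: b_def)
  \<comment> \<open>One exponent serves all consecutive balls: 1 is needed in the concentric chain,
    4 for the jump to \<open>w0\<close>, and \<open>j + 1\<close> along the light balls.\<close>
  define L where "L = D ^ (j + 4)"
  have D_pow_L: "D ^ n \<le> L" if "n \<le> j + 4" for n
    unfolding L_def using that D_ge_1 by (rule power_increasing)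
  have intB: "(\<integral>\<^sup>+ z \<in> ball x (2 * d). energy z \<partial>\<mu>) \<le> ennreal (h * measure \<mu> (ball x (2 * d)))"
    using int[of "2 * d"] d by (simp add: h_def)
  obtain z where z: "z \<in> ball x (2 * d)" "energy z \<le> ennreal (4 * h)"
    using good_point_exists[OF _ h intB] d by auto

  have "\<bar>u z - u x\<bar> \<le> step_const L * (b / (1 - 2 powr (\<alpha> - s)))"
  proof (rule chain_bound[where w = "\<lambda>_. x" and \<rho> = "\<lambda>k. 2 * d / 2 ^ k"
        and h = "\<lambda>k. m * (2 * d / 2 ^ k) powr (- \<alpha> * p)"])
    fix k :: nat
    show \<rho>: "0 < 2 * d / 2 ^ k" for k :: nat using d by simp
    show "0 < m * (2 * d / 2 ^ k) powr (- \<alpha> * p)" using m d by simp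
    show "(\<integral>\<^sup>+ z \<in> ball x (2 * d / 2 ^ k). energy z \<partial>\<mu>) \<le>
        ennreal (m * (2 * d / 2 ^ k) powr (- \<alpha> * p) * measure \<mu> (ball x (2 * d / 2 ^ k)))"
      using \<rho> by (rule int)
    show "ball x (2 * d / 2 ^ Suc k) \<subseteq> ball x (2 * d / 2 ^ k)"
      using d by (intro subset_ball) (simp add: field_simps)
    have "measure \<mu> (ball x (2 * d / 2 ^ k)) \<le> D ^ 1 * measure \<mu> (ball x (2 * d / 2 ^ Suc k))"
      by (rule measure_ball_le[OF \<rho>]) simp
    also have "\<dots> \<le> L * measure \<mu> (ball x (2 * d / 2 ^ Suc k))"
      by (intro mult_right_mono D_pow_L) auto
    finally show "measure \<mu> (ball x (2 * d / 2 ^ k)) \<le> L * measure \<mu> (ball x (2 * d / 2 ^ Suc k))" .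
    \<comment> \<open>The \<open>p\<close>-th root turns \<open>r powr (- \<alpha> * p)\<close> into
      \<open>r powr (- \<alpha>)\<close>; the exponent \<open>s - \<alpha>\<close> remains and gives
      the ratio \<open>2 powr (\<alpha> - s)\<close>.\<close>
    have "(2 * d / 2 ^ k) powr s * (m * (2 * d / 2 ^ k) powr (- \<alpha> * p)) powr (1 / p)
        = (2 * d / 2 ^ k) powr (s - \<alpha>) * m powr (1 / p)"
      using m d p_ge_1 by (simp add: powr_mult powr_powr powr_add[symmetric] mult.left_commute)
    also have "\<dots> = b * ((1 / 2 ^ k) powr (s - \<alpha>))"
      using d by (simp add: b_def powr_mult powr_divide mult_ac)
    also have "(1 / 2 ^ k) powr (s - \<alpha>) = (2 powr (\<alpha> - s)) ^ k"
      using power_powr[of "1 / 2 :: real" k "s - \<alpha>"]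
      by (simp add: power_one_over powr_divide powr_minus_divide[of 2 "s - \<alpha>", symmetric])
    finally show "(2 * d / 2 ^ k) powr s * (m * (2 * d / 2 ^ k) powr (- \<alpha> * p)) powr (1 / p)
        \<le> b * (2 powr (\<alpha> - s)) ^ k" by simp
  next
    show "2 powr (\<alpha> - s) < 1" using \<alpha> powr_less_mono[of "\<alpha> - s" 0 2] by simp
    show "(\<lambda>k. 2 * d / 2 ^ k) \<longlonglongrightarrow> 0"
      using LIMSEQ_divide_realpow_zero[of 2 "2 * d"] by simp
  qed (use z A in \<open>simp_all add: h_def\<close>)
  moreover
  \<comment> \<open>Four doublings of \<open>d / 4\<close> reach \<open>4 * d\<close>, which exceeds
    \<open>3 / 2 * d + 2 * d\<close>.\<close>
  have D4: "measure \<mu> (ball x (2 * d)) \<le> D ^ 4 * measure \<mu> (ball w0 (d / 4))"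
  proof (rule measure_ball_le)
    show "ball x (2 * d) \<subseteq> ball w0 (2 ^ 4 * (d / 4))"
    proof
      fix v assume "v \<in> ball x (2 * d)"
      then show "v \<in> ball w0 (2 ^ 4 * (d / 4))"
        using w0(2) dist_triangle3[of w0 v x] d by auto
    qed
  qed (use d in simp)
  have sub0: "ball w0 (d / 4) \<subseteq> ball x (2 * d)"
  proof
    fix v assume "v \<in> ball w0 (d / 4)"
    then show "v \<in> ball x (2 * d)"
      using w0(2) dist_triangle[of x v w0] d by auto
  qed
  have int0: "(\<integral>\<^sup>+ z \<in> ball w0 (d / 4). energy z \<partial>\<mu>) \<le> ennreal (h * D ^ 4 * measure \<mu> (ball w0 (d / 4)))"
  proof -
    have "(\<integral>\<^sup>+ z \<in> ball w0 (d / 4). energy z \<partial>\<mu>) \<le> (\<integral>\<^sup>+ z \<in> ball x (2 * d). energy z \<partial>\<mu>)"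
      using sub0 by (intro nn_integral_mono) (auto simp: indicator_def)
    also note intB
    also have "ennreal (h * measure \<mu> (ball x (2 * d))) \<le> ennreal (h * D ^ 4 * measure \<mu> (ball w0 (d / 4)))"
      using mult_left_mono[OF D4, of h] h by (intro ennreal_leI) (simp add: mult_ac)
    finally show ?thesis .
  qed
  have N: "4 \<le> (2::real) ^ j" using power_increasing[OF j, of "2::real"] by simp
  define q where "q = D ^ 3 / \<delta>"
  have q: "0 < q" using \<delta> D_ge_1 by (simp add: q_def)
  obtain w l where w: "w 0 = w0" "w \<longlonglongrightarrow> l" "l \<in> E"
    and nest: "\<And>k. ball (w (Suc k)) (d / 4 / (2 ^ j) ^ Suc k) \<subseteq> ball (w k) (d / 4 / (2 ^ j) ^ k)"
    and intw: "\<And>k. (\<integral>\<^sup>+ z \<in> ball (w k) (d / 4 / (2 ^ j) ^ k). energy z \<partial>\<mu>) \<le>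
      ennreal (h * D ^ 4 * q ^ k * measure \<mu> (ball (w k) (d / 4 / (2 ^ j) ^ k)))"
    unfolding q_def
    by (rule light_nested_balls[OF energy_measurable E w0(1) _ N \<delta> _ dens int0])
      (use d h D_ge_1 in auto)
  \<comment> \<open>The light balls are shifted by one index so that \<open>ball x (2 * d)\<close>,
    which contains \<open>z\<close>, starts the second chain.\<close>
  define R where "R k = (case k of 0 \<Rightarrow> 2 * d | Suc i \<Rightarrow> d / 4 / (2 ^ j) ^ i)" for k
  define W where "W k = (case k of 0 \<Rightarrow> x | Suc i \<Rightarrow> w i)" for k
  define H where "H k = (case k of 0 \<Rightarrow> h | Suc i \<Rightarrow> h * D ^ 4 * q ^ i)" for k
  have "\<bar>u z - u l\<bar> \<le> step_const L * (2 * D ^ 4 * b / (1 - 1 / 2))"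
  proof (rule chain_bound[where w = W and \<rho> = R and h = H])
    fix k
    show R: "0 < R k" for k using d by (simp add: R_def split: nat.split)
    show "0 < H k" using h q D_ge_1 by (simp add: H_def split: nat.split)
    show "(\<integral>\<^sup>+ z \<in> ball (W k) (R k). energy z \<partial>\<mu>) \<le> ennreal (H k * measure \<mu> (ball (W k) (R k)))"
      unfolding R_def W_def H_def using intB intw
      by (cases k) (simp_all only: nat.case)
    show nestW: "ball (W (Suc k)) (R (Suc k)) \<subseteq> ball (W k) (R k)"
      unfolding R_def W_def using sub0 nest by (cases k) (simp_all add: w(1))
    show "measure \<mu> (ball (W k) (R k)) \<le> L * measure \<mu> (ball (W (Suc k)) (R (Suc k)))"
    proof (cases k)
      case 0
      have "D ^ 4 * measure \<mu> (ball w0 (d / 4)) \<le> L * measure \<mu> (ball w0 (d / 4))"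
        by (intro mult_right_mono D_pow_L) auto
      then show ?thesis using D4 0 by (simp add: W_def R_def w(1))
    next
      case (Suc i)
      \<comment> \<open>Doubling compares concentric balls, so the larger ball is recentred at the
        next centre, at the price of twice its radius.\<close>
      have "W (Suc k) \<in> ball (W k) (R k)" using nestW R[of "Suc k"] centre_in_ball by blast
      moreover have "2 ^ Suc j * R (Suc k) = 2 * R k" by (simp add: R_def Suc)
      ultimately have "ball (W k) (R k) \<subseteq> ball (W (Suc k)) (2 ^ Suc j * R (Suc k))"
        using dist_triangle3[of "W (Suc k)" _ "W k"] unfolding subset_iff mem_ball
        by (smt (verit))
      then have "measure \<mu> (ball (W k) (R k)) \<le> D ^ Suc j * measure \<mu> (ball (W (Suc k)) (R (Suc k)))"
        by (rule measure_ball_le[OF R])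
      also have "\<dots> \<le> L * measure \<mu> (ball (W (Suc k)) (R (Suc k)))"
        by (intro mult_right_mono D_pow_L) auto
      finally show ?thesis .
    qed
    \<comment> \<open>The factor 2 pays for the index shift; \<open>D ^ 4\<close> absorbs
      \<open>(D ^ 4) powr (1 / p)\<close>, using \<open>1 \<le> p\<close>.\<close>
    show "R k powr s * H k powr (1 / p) \<le> 2 * D ^ 4 * b * (1 / 2) ^ k"
    proof (cases k)
      case 0
      have "1 * b \<le> (2 * D ^ 4) * b"
        using b one_le_power[OF D_ge_1, of 4] by (intro mult_right_mono) auto
      then show ?thesis using b_h 0 by (simp add: R_def H_def)
    next
      case (Suc i)
      have D4p: "(D ^ 4) powr (1 / p) \<le> D ^ 4"
        using powr_mono[of "1 / p" 1 "D ^ 4"] one_le_power[OF D_ge_1, of 4] p_ge_1 by simp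
      have "(1 / ((2 ^ j) ^ i)) powr s = ((2 ^ j) powr (- s)) ^ i"
        using power_powr[of "1 / 2 ^ j :: real" i s]
        by (simp add: power_one_over powr_divide powr_minus_divide)
      moreover have "(q ^ i) powr (1 / p) = (q powr (1 / p)) ^ i"
        using q by (rule power_powr)
      ultimately have e: "(1 / ((2 ^ j) ^ i)) powr s * (q ^ i) powr (1 / p) \<le> (1 / 2) ^ i"
        using power_mono[OF small, of i] by (simp add: power_mult_distrib q_def)
      have "R k powr s * H k powr (1 / p) = (d / 4) powr s * h powr (1 / p) * (D ^ 4) powr (1 / p) *
          ((1 / ((2 ^ j) ^ i)) powr s * (q ^ i) powr (1 / p))"
        using d h q D_ge_1 unfolding R_def H_def Suc by (simp add: powr_mult powr_divide)
      also have "\<dots> \<le> (2 * d) powr s * h powr (1 / p) * D ^ 4 * (1 / 2) ^ i"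
        using e D4p d h s_pos p_ge_1 D_ge_1 by (intro mult_mono powr_mono2) auto
      also have "\<dots> = 2 * D ^ 4 * b * (1 / 2) ^ k"
        unfolding b_h by (simp add: Suc)
      finally show ?thesis .
    qed
  next
    show "W \<longlonglongrightarrow> l"
      using w(2) by (subst filterlim_sequentially_Suc[symmetric]) (simp add: W_def)
    have "(\<lambda>i. d / 4 / (2 ^ j) ^ i) \<longlonglongrightarrow> 0"
      using LIMSEQ_divide_realpow_zero[of "2 ^ j" "d / 4"] N by simp
    then show "R \<longlonglongrightarrow> 0"
      by (subst filterlim_sequentially_Suc[symmetric]) (simp add: R_def)
  qed (use z A in \<open>simp_all add: W_def R_def H_def\<close>)
  ultimately have "\<bar>u x\<bar> \<le> step_const L * (b / (1 - 2 powr (\<alpha> - s))) + step_const L * (4 * D ^ 4 * b)"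
    using u0[OF w(3)] by simp
  then show ?thesis
    unfolding b_def[symmetric] L_def[symmetric] by (simp add: algebra_simps)
qed

end

section \<open>Choice of the constants and passage to the maximal function\<close>

theorem theorem5p1:
  fixes \<mu> :: "'a::metric_space measure"
    and \<alpha> p q s t :: real
    and E :: "'a set"
  assumes "metric_measure_space \<mu>"
    and "doubling \<mu>"
    and "1 \<le> p" and "p \<le> q"
    and "0 < s" and "s < 1" and "\<alpha> < s"
    and "1 \<le> t"
    and "complete (UNIV :: 'a set)"
    and "supports_poincare \<mu> s q p t"
    and "reverse_doubling \<mu>"
    and "closed E"
    and "upper_assouad_codim \<mu> E < ereal (s * p)"
  shows "\<exists>C>0. \<forall>u :: 'a \<Rightarrow> real.
           continuous_on UNIV u \<and> (\<forall>x\<in>E. u x = 0) \<longrightarrow>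
           (\<forall>x. 0 < infdist x E \<and> ereal (infdist x E) < ediam E \<longrightarrow>
              (let B = ball x (2 * infdist x E) in
                 ennreal \<bar>u x\<bar> \<le>
                   ennreal (C * infdist x E powr (s - \<alpha>)) *
                   ennreal_powr
                     (frac_maximal \<mu> (\<alpha> * p)
                       (\<lambda>y. indicator B y * ennreal_powr (frac_grad \<mu> u s t B y) p) x)
                     (1 / p)))"
proof -
  from assms(2) obtain D where D: "1 \<le> D"
    "\<And>x r. 0 < r \<Longrightarrow> measure \<mu> (ball x (2 * r)) \<le> D * measure \<mu> (ball x r)"
    unfolding doubling_def by blast
  interpret doubling_measure \<mu> D
    using assms(1) D by unfold_locales (auto simp: metric_measure_space_def)
  \<comment> \<open>An infimum below \<open>s * p\<close> leaves an admissible exponent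
    \<open>Q\<close> that is itself below \<open>s * p\<close>.\<close>
  from assms(13) obtain Q c where Q: "Q < s * p" and c: "0 < c"
    and codim: "\<And>w r R. \<lbrakk>w \<in> E; 0 < r; r < R; is_singleton E \<or> ereal R < ediam E\<rbrakk> \<Longrightarrow>
      c * (r / R) powr Q \<le> measure \<mu> ({y. infdist y E < r} \<inter> ball w R) / measure \<mu> (ball w R)"
    unfolding upper_assouad_codim_def Inf_less_iff by auto
  \<comment> \<open>The codimension bound for the radii \<open>r / 2 ^ j\<close> and
    \<open>r / 2\<close>, whose quotient is \<open>2 / 2 ^ j\<close>.\<close>
  define \<delta> where "\<delta> j = c * (2 / 2 ^ j) powr Q" for j :: nat
  define K where "K = (D ^ 3 / (c * 2 powr Q)) powr (1 / p)"
  \<comment> \<open>\<open>\<delta> j\<close> depends on \<open>j\<close> too, and the factor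
    \<open>D ^ 3 / \<delta> j\<close> may grow with it; the shrinking radii still win because
    \<open>Q / p - s\<close> is negative.\<close>
  have eta: "(2 ^ j) powr (- s) * (D ^ 3 / \<delta> j) powr (1 / p) = K * (2 powr (Q / p - s)) ^ j" for j
  proof -
    define X where "X = D ^ 3 / (c * 2 powr Q)"
    have "D ^ 3 / \<delta> j = X * 2 powr (Q * j)"
      by (simp add: X_def \<delta>_def powr_divide powr_realpow[symmetric] powr_powr mult_ac)
    then have "(D ^ 3 / \<delta> j) powr (1 / p) = K * 2 powr (Q * j / p)"
      using D(1) c unfolding K_def X_def[symmetric] by (simp add: powr_mult powr_powr)
    then show ?thesis
      by (simp add: powr_realpow[symmetric] powr_powr powr_power powr_add[symmetric] algebra_simps)
  qed
  have "2 powr (Q / p - s) < (1::real)"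
    using Q assms(3) powr_less_mono[of "Q / p - s" 0 2] by (simp add: field_simps)
  then have "(\<lambda>j. K * (2 powr (Q / p - s)) ^ j) \<longlonglongrightarrow> 0"
    by (intro tendsto_mult_right_zero LIMSEQ_realpow_zero) auto
  then have "\<forall>\<^sub>F j in sequentially. K * (2 powr (Q / p - s)) ^ j < 1 / 2 \<and> 2 \<le> j"
    by (intro eventually_conj order_tendstoD(2) eventually_ge_at_top) auto
  then obtain j where j: "2 \<le> j" and small: "(2 ^ j) powr (- s) * (D ^ 3 / \<delta> j) powr (1 / p) \<le> 1 / 2"
    unfolding eta by (auto simp: eventually_sequentially less_imp_le)
  \<comment> \<open>\<open>step_const (D ^ (j + 4))\<close> is written out because \<open>C\<close>
    is fixed before \<open>u\<close>, on which the locale depends;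
    \<open>2 powr (s - \<alpha>)\<close> comes from the radius \<open>2 * d\<close>.\<close>
  define C where "C = (4 * D ^ (j + 4) * D\<^sup>2) powr (1 / t) * 4 powr (1 / p) * 2 powr s *
    ((1 / (1 - 2 powr (\<alpha> - s)) + 4 * D ^ 4) * 2 powr (s - \<alpha>))"
  have "2 powr (\<alpha> - s) < (1::real)"
    using assms(7) powr_less_mono[of "\<alpha> - s" 0 2] by simp
  then have C: "0 < C"
    unfolding C_def using D(1) by (intro mult_pos_pos add_pos_pos) auto
  show ?thesis
  proof (intro exI[of _ C] conjI C allI impI)
    fix u :: "'a \<Rightarrow> real" and x
    assume u: "continuous_on UNIV u \<and> (\<forall>x\<in>E. u x = 0)"
      and x: "0 < infdist x E \<and> ereal (infdist x E) < ediam E"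
    define d where "d = infdist x E"
    define B where "B = ball x (2 * d)"
    define M where "M = frac_maximal \<mu> (\<alpha> * p)
      (\<lambda>y. indicator B y * ennreal_powr (frac_grad \<mu> u s t B y) p) x"
    have d: "0 < d" "ereal d < ediam E" using x by (auto simp: d_def)
    interpret fractional_oscillation \<mu> D u B s t p
      using u assms by unfold_locales auto
    have "E \<noteq> {}" using d by (auto simp: d_def infdist_def)
    then obtain w0 where w0: "w0 \<in> E" "dist x w0 < 3 / 2 * d"
      using d(1) infdist_notempty[of E x] cINF_less_iff[of E "dist x" "3 / 2 * d"]
      by (force simp: d_def bdd_below_def intro: zero_le_dist)
    have dens: "\<delta> j * measure \<mu> (ball w (r / 2)) \<le>
        measure \<mu> ({y. infdist y E < r / 2 ^ j} \<inter> ball w (r / 2))"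
      if "w \<in> E" "0 < r" "r \<le> d / 4" for w r
    proof -
      have "(4::real) \<le> 2 ^ j" using power_increasing[OF j, of "2::real"] by simp
      then have "r / 2 ^ j < r / 2" using that by (intro divide_strict_left_mono) auto
      \<comment> \<open>\<open>r \<le> d / 4\<close> and \<open>d < ediam E\<close> put
        \<open>r / 2\<close> among the scales covered by \<open>codim\<close>.\<close>
      moreover have "ereal (r / 2) < ediam E"
        using that d by (intro le_less_trans[OF _ d(2)]) simp
      ultimately have "c * (r / 2 ^ j / (r / 2)) powr Q \<le>
          measure \<mu> ({y. infdist y E < r / 2 ^ j} \<inter> ball w (r / 2)) / measure \<mu> (ball w (r / 2))"
        using that by (intro codim) auto
      then show ?thesis
        using that measure_ball_pos[of "r / 2" w] by (simp add: \<delta>_def pos_le_divide_eq)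
    qed
    \<comment> \<open>Stated for any positive real majorant \<open>m\<close> of \<open>M\<close>, as
      \<open>pointwise_bound\<close> asks for \<open>0 < m\<close>; the values zero and infinity of
      \<open>M\<close> are treated afterwards.\<close>
    have bound: "\<bar>u x\<bar> \<le> C * d powr (s - \<alpha>) * m powr (1 / p)" if m: "0 < m" "M \<le> ennreal m" for m
    proof -
      have "(\<integral>\<^sup>+ z \<in> ball x r. energy z \<partial>\<mu>) \<le> ennreal (m * r powr (- \<alpha> * p) * measure \<mu> (ball x r))"
        if r: "0 < r" for r
      proof -
        let ?f = "\<lambda>y. indicator B y * ennreal_powr (frac_grad \<mu> u s t B y) p"
        have "ennreal (r powr (\<alpha> * p)) * nn_mean \<mu> (ball x r) ?f \<le> M"
          unfolding M_def frac_maximal_def using r by (intro SUP_upper) auto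
        also note m(2)
        finally have "ennreal (r powr (- \<alpha> * p)) * (ennreal (r powr (\<alpha> * p)) * nn_mean \<mu> (ball x r) ?f)
            \<le> ennreal (r powr (- \<alpha> * p)) * ennreal m"
          by (intro mult_left_mono) auto
        moreover have "ennreal (r powr (- \<alpha> * p)) * ennreal (r powr (\<alpha> * p)) = 1"
          using r by (simp add: ennreal_mult[symmetric] powr_add[symmetric])
        ultimately have "nn_mean \<mu> (ball x r) ?f \<le> ennreal (m * r powr (- \<alpha> * p))"
          using m by (simp add: mult.assoc[symmetric] ennreal_mult[symmetric] mult.commute)
        then have "(\<integral>\<^sup>+ z \<in> ball x r. ?f z \<partial>\<mu>) \<le> ennreal (m * r powr (- \<alpha> * p)) * emeasure \<mu> (ball x r)"
          unfolding nn_mean_def using ball_pos[OF r, of x] ball_finite[OF r, of x]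
          by (subst (asm) divide_le_ennreal_iff) auto
        moreover have "(\<integral>\<^sup>+ z \<in> ball x r. energy z \<partial>\<mu>) \<le> (\<integral>\<^sup>+ z \<in> ball x r. ?f z \<partial>\<mu>)"
          by (intro nn_integral_mono mult_right_mono energy_le_frac_grad) auto
        ultimately show ?thesis
          using m by (simp add: emeasure_ball[OF r] ennreal_mult[symmetric])
      qed
      then have "\<bar>u x\<bar> \<le> step_const (D ^ (j + 4)) *
          ((1 / (1 - 2 powr (\<alpha> - s)) + 4 * D ^ 4) * ((2 * d) powr (s - \<alpha>) * m powr (1 / p)))"
        using u c by (intro pointwise_bound[OF B_def d(1) m(1) assms(7) _ assms(12,9) _ w0 j _ dens small])
          (auto simp: \<delta>_def)
      also have "\<dots> = C * d powr (s - \<alpha>) * m powr (1 / p)"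
        using d by (simp add: C_def step_const_def powr_mult)
      finally show ?thesis .
    qed
    have "ennreal \<bar>u x\<bar> \<le> ennreal (C * d powr (s - \<alpha>)) * ennreal_powr M (1 / p)"
    proof (cases M)
      case (real m)
      show ?thesis
      proof (cases "m = 0")
        case True
        have "\<bar>u x\<bar> \<le> 0"
        proof (rule field_le_epsilon)
          fix e :: real assume e: "0 < e"
          \<comment> \<open>The positive majorant of \<open>M = 0\<close> for which
            \<open>bound\<close> gives exactly \<open>e\<close>.\<close>
          define k where "k = (e / (C * d powr (s - \<alpha>))) powr p"
          have "k powr (1 / p) = e / (C * d powr (s - \<alpha>))"
            using e C d assms(3) by (simp add: k_def powr_powr)
          moreover have "0 < k" using e C d by (simp add: k_def)
          ultimately show "\<bar>u x\<bar> \<le> 0 + e"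
            using bound[of k] real True C d by simp
        qed
        then show ?thesis by simp
      next
        case False
        then show ?thesis
          using bound[of m] real C by (simp add: ennreal_powr_ennreal ennreal_mult[symmetric] ennreal_leI)
      qed
    next
      case top
      then show ?thesis using C d by (simp add: ennreal_powr_def ennreal_mult_top)
    qed
    then show "let B = ball x (2 * infdist x E) in
        ennreal \<bar>u x\<bar> \<le> ennreal (C * infdist x E powr (s - \<alpha>)) *
          ennreal_powr (frac_maximal \<mu> (\<alpha> * p)
            (\<lambda>y. indicator B y * ennreal_powr (frac_grad \<mu> u s t B y) p) x) (1 / p)"
      unfolding Let_def M_def B_def d_def .
  qed
qed

end
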